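(* Let $n\ge 2$ be an integer and let $\mathcal{SP}^n$ be Kendall's 2D shape manifold generated by $n$ landmarks. A kernel $k : \mathcal{SP}^n\times\mathcal{SP}^n\to\mathbb{R}$ is radial with respect to the full Procrustes distance $d_{FP}$ and is positive definite if it admits a series representation of the form $$k([\mathbf{z}_1],[\mathbf{z}_2]) = \sum_{i=0}^{\infty} a_i\, |\langle \mathbf{z}_1,\mathbf{z}_2\rangle|^{2i} + a_{-1}\, 1_{\{1\}}\big(|\langle \mathbf{z}_1,\mathbf{z}_2\rangle|^2\big)\quad\text{for all } [\mathbf{z}_1],[\mathbf{z}_2]\in\mathcal{SP}^n,$$ where $(a_i)_{i\ge -1}$ are real numbers with $a_i\ge 0$ for all $i$ and $\sum_{i\ge -1} a_i<\infty$.
   Context: A pre-shape with $n$ landmarks is a vector $\mathbf{z}\in\mathbb{C}^n$ (the complex coordinates of $n$ points in the plane) whose coordinates have mean zero and which has unit norm in the standard Hermitian inner product $\langle\cdot,\cdot\rangle$ of $\mathbb{C}^n$. The shape manifold $\mathcal{SP}^n$ is the set of equivalence classes $[\mathbf{z}]$ of pre-shapes, where two pre-shapes are equivalent if one is obtained from the other by a rotation, i.e. by multiplication by $e^{\mathrm{i}\theta}$, $\theta\in\mathbb{R}$ (so $\mathcal{SP}^n$ is identified with the complex projective space $\mathbb{C}P^{n-2}$). The full Procrustes distance is $$d_{FP}([\mathbf{z}_1],[\mathbf{z}_2]) = \big(1-|\langle \mathbf{z}_1,\mathbf{z}_2\rangle|^2\big)^{1/2}.$$ $1_A(t)$ is the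 indicator function: $1_A(t)=1$ if $t\in A$ and $0$ otherwise. The $i=0$ power is the constant $1$ (convention $0^0=1$). A kernel on a nonempty set $\mathcal{X}$ is a function $f:\mathcal{X}\times\mathcal{X}\to\mathbb{R}$. It is positive definite if it is symmetric and $\sum_{i,j=1}^m c_ic_jf(x_i,x_j)\ge 0$ for all $m\in\mathbb{N}$, $x_1,\dots,x_m\in\mathcal{X}$, $c_1,\dots,c_m\in\mathbb{R}$. A kernel $k$ on a metric space $(M,d)$ is radial (with respect to $d$) if there is a function $\varphi:[0,\infty)\to\mathbb{R}$ with $k(x,y)=\varphi(d(x,y))$ for all $x,y\in M$. *)

theory Defs
  imports "HOL-Analysis.Analysis"
begin

definition hermitian :: "complex ^ 'n \<Rightarrow> complex ^ 'n \<Rightarrow> complex" where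
  "hermitian z w = (\<Sum>i\<in>UNIV. z $ i * cnj (w $ i))"

text \<open>The library norm on \<^typ>\<open>complex ^ 'n\<close> is the one induced by this Hermitian product.\<close>

lemma hermitian_self: "hermitian z z = complex_of_real ((norm z)\<^sup>2)"
proof -
  have "(norm z)\<^sup>2 = (\<Sum>i\<in>UNIV. (cmod (z $ i))\<^sup>2)"
    by (simp add: norm_vec_def L2_set_def sum_nonneg)
  then show ?thesis
    by (simp add: hermitian_def complex_norm_square del: of_real_power)
qed

definition preshapes :: "(complex ^ 'n) set" where
  "preshapes = {z. (\<Sum>i\<in>UNIV. z $ i) / of_nat CARD('n) = 0 \<and> norm z = 1}"

definition rotation_rel :: "((complex ^ 'n) \<times> (complex ^ 'n)) set" where
  "rotation_rel = {(z, w). z \<in> preshapes \<and> w \<in> preshapes \<and>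
     (\<exists>\<theta>::real. w = (\<chi> i. exp (\<i> * of_real \<theta>) * z $ i))}"

definition shape_space :: "(complex ^ 'n) set set" where
  "shape_space = preshapes // rotation_rel"

definition shape :: "complex ^ 'n \<Rightarrow> (complex ^ 'n) set" where
  "shape z = rotation_rel `` {z}"

lemma equiv_rotation_rel: "equiv preshapes rotation_rel"
proof (rule equivI)
  show "rotation_rel \<subseteq> preshapes \<times> preshapes"
    by (auto simp: rotation_rel_def)
  show "refl_on preshapes rotation_rel"
    by (auto simp: rotation_rel_def refl_on_def intro!: exI[of _ 0])
  show "sym rotation_rel"
  proof (rule symI)
    fix z w :: "complex ^ 'n" assume "(z, w) \<in> rotation_rel"
    then obtain t :: real where t: "z \<in> preshapes" "w \<in> preshapes"
      "w = (\<chi> i. exp (\<i> * of_real t) * z $ i)" by (auto simp: rotation_rel_def)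
    have "z = (\<chi> i. exp (\<i> * of_real (- t)) * w $ i)"
      by (simp add: t(3) vec_eq_iff exp_minus field_simps)
    with t show "(w, z) \<in> rotation_rel" unfolding rotation_rel_def by blast
  qed
  show "trans rotation_rel"
  proof (rule transI)
    fix x y z :: "complex ^ 'n"
    assume "(x, y) \<in> rotation_rel" "(y, z) \<in> rotation_rel"
    then obtain s t :: real where *: "x \<in> preshapes" "z \<in> preshapes"
      "y = (\<chi> i. exp (\<i> * of_real s) * x $ i)" "z = (\<chi> i. exp (\<i> * of_real t) * y $ i)"
      by (auto simp: rotation_rel_def)
    have "z = (\<chi> i. exp (\<i> * of_real (s + t)) * x $ i)"
      by (simp add: *(3,4) vec_eq_iff exp_add distrib_left mult_ac)
    with * show "(x, z) \<in> rotation_rel" unfolding rotation_rel_def by blast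
  qed
qed

lemma shape_in_shape_space: "z \<in> preshapes \<Longrightarrow> shape z \<in> shape_space"
  by (simp add: shape_def shape_space_def quotientI)

lemma cmod_hermitian_rotation:
  assumes "(z, z') \<in> rotation_rel" "(w, w') \<in> rotation_rel"
  shows "cmod (hermitian z' w') = cmod (hermitian z w)"
proof -
  obtain s t :: real where *: "z' = (\<chi> i. exp (\<i> * of_real s) * z $ i)"
    "w' = (\<chi> i. exp (\<i> * of_real t) * w $ i)"
    using assms by (auto simp: rotation_rel_def)
  have "hermitian z' w' = (exp (\<i> * of_real s) * cnj (exp (\<i> * of_real t))) * hermitian z w"
    by (simp add: hermitian_def * sum_distrib_left mult_ac)
  then show ?thesis
    by (simp add: norm_mult)
qed

text \<open>The distance of two shapes is the common value of the formula over all their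
  representatives; \<open>d_FP_shape\<close> shows that there is exactly one such value.\<close>

definition d_FP :: "(complex ^ 'n) set \<Rightarrow> (complex ^ 'n) set \<Rightarrow> real" where
  "d_FP A B = the_elem ((\<lambda>(z, w). sqrt (1 - (cmod (hermitian z w))\<^sup>2)) ` (A \<times> B))"

lemma d_FP_shape:
  assumes "z \<in> preshapes" "w \<in> preshapes"
  shows "d_FP (shape z) (shape w) = sqrt (1 - (cmod (hermitian z w))\<^sup>2)"
proof -
  have "(\<lambda>(z, w). sqrt (1 - (cmod (hermitian z w))\<^sup>2)) ` (shape z \<times> shape w)
      = {sqrt (1 - (cmod (hermitian z w))\<^sup>2)}"
  proof (rule set_eqI, rule iffI)
    fix r assume "r \<in> (\<lambda>(z, w). sqrt (1 - (cmod (hermitian z w))\<^sup>2)) ` (shape z \<times> shape w)"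
    then show "r \<in> {sqrt (1 - (cmod (hermitian z w))\<^sup>2)}"
      by (auto simp: shape_def cmod_hermitian_rotation)
  next
    fix r assume "r \<in> {sqrt (1 - (cmod (hermitian z w))\<^sup>2)}"
    moreover have "(z, w) \<in> shape z \<times> shape w"
      using assms equiv_class_self[OF equiv_rotation_rel] by (auto simp: shape_def)
    ultimately show "r \<in> (\<lambda>(z, w). sqrt (1 - (cmod (hermitian z w))\<^sup>2)) ` (shape z \<times> shape w)"
      by (auto intro!: image_eqI[of _ _ "(z, w)"])
  qed
  then show ?thesis
    by (simp add: d_FP_def)
qed

definition positive_definite_kernel :: "'a set \<Rightarrow> ('a \<Rightarrow> 'a \<Rightarrow> real) \<Rightarrow> bool" where
  "positive_definite_kernel X f \<longleftrightarrow>
     (\<forall>x\<in>X. \<forall>y\<in>X. f x y = f y x) \<and>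
     (\<forall>(m::nat) (x :: nat \<Rightarrow> 'a) (c :: nat \<Rightarrow> real). (\<forall>i<m. x i \<in> X) \<longrightarrow>
        (\<Sum>i<m. \<Sum>j<m. c i * c j * f (x i) (x j)) \<ge> 0)"

text \<open>Only the values of \<open>\<phi>\<close> on \<open>[0, \<infinity>)\<close> matter when \<open>d\<close> is a metric on \<open>M\<close>.\<close>

definition radial_kernel :: "'a set \<Rightarrow> ('a \<Rightarrow> 'a \<Rightarrow> real) \<Rightarrow> ('a \<Rightarrow> 'a \<Rightarrow> real) \<Rightarrow> bool" where
  "radial_kernel M d k \<longleftrightarrow>
     (\<exists>\<phi> :: real \<Rightarrow> real. \<forall>x\<in>M. \<forall>y\<in>M. k x y = \<phi> (d x y))"

end

(* Expanding one factor of the Hermitian product h = \<langle>z, w\<rangle> in coordinates absorbs it into the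
   coefficients of a complex quadratic form, so positivity passes from a kernel M to h * M and to
   cnj h * M; hence all powers |h|^(2 i) are positive definite. The indicator term needs no equality
   case of the Cauchy-Schwarz inequality: 1_{1}(t) is the limit of t^i for t in [0, 1], and
   positive definiteness is preserved by pointwise limits. *)

theory Submission imports Defs begin

lemma positive_definite_kernel_cong:
  assumes "\<And>x y. x \<in> X \<Longrightarrow> y \<in> X \<Longrightarrow> f x y = g x y"
  shows "positive_definite_kernel X f \<longleftrightarrow> positive_definite_kernel X g"
proof -
  have "(\<Sum>i<m. \<Sum>j<m. c i * c j * f (x i) (x j)) = (\<Sum>i<m. \<Sum>j<m. c i * c j * g (x i) (x j))"
    if "\<forall>i<m. x i \<in> X" for m :: nat and x and c :: "nat \<Rightarrow> real"
    using that by (intro sum.cong refl) (simp add: assms)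
  then show ?thesis
    unfolding positive_definite_kernel_def by (simp add: assms cong: ball_cong)
qed

lemma positive_definite_kernel_zero: "positive_definite_kernel X (\<lambda>_ _. 0)"
  by (simp add: positive_definite_kernel_def)

lemma positive_definite_kernel_add:
  assumes "positive_definite_kernel X f" "positive_definite_kernel X g"
  shows "positive_definite_kernel X (\<lambda>x y. f x y + g x y)"
  using assms by (simp add: positive_definite_kernel_def distrib_left sum.distrib)

lemma positive_definite_kernel_cmult:
  assumes "positive_definite_kernel X f" "0 \<le> r"
  shows "positive_definite_kernel X (\<lambda>x y. r * f x y)"
proof -
  have "(\<Sum>i<m. \<Sum>j<m. c i * c j * (r * f (x i) (x j)))
      = r * (\<Sum>i<m. \<Sum>j<m. c i * c j * f (x i) (x j))" for m :: nat and x c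
    by (simp add: sum_distrib_left mult_ac)
  with assms show ?thesis
    by (simp add: positive_definite_kernel_def)
qed

lemma positive_definite_kernel_sum:
  assumes "\<And>i. i \<in> I \<Longrightarrow> positive_definite_kernel X (f i)"
  shows "positive_definite_kernel X (\<lambda>x y. \<Sum>i\<in>I. f i x y)"
  using assms
  by (induction I rule: infinite_finite_induct)
     (auto intro: positive_definite_kernel_zero positive_definite_kernel_add)

text \<open>Symmetry and each single quadratic form involve only finitely many values of the kernel,
  so pointwise convergence on \<open>X\<close> suffices. This serves both for the infinite series
  and for the indicator term.\<close>

lemma positive_definite_kernel_limit:
  assumes pd: "\<And>n. positive_definite_kernel X (f n)"
    and lim: "\<And>x y. x \<in> X \<Longrightarrow> y \<in> X \<Longrightarrow> (\<lambda>n. f n x y) \<longlonglongrightarrow> g x y"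
  shows "positive_definite_kernel X g"
  unfolding positive_definite_kernel_def
proof (intro conjI ballI allI impI)
  fix x y assume xy: "x \<in> X" "y \<in> X"
  have "f n x y = f n y x" for n
    using pd[of n] xy by (simp add: positive_definite_kernel_def)
  then show "g x y = g y x"
    using lim[OF xy] lim[OF xy(2,1)] LIMSEQ_unique by simp
next
  fix m :: nat and x and c :: "nat \<Rightarrow> real"
  assume x: "\<forall>i<m. x i \<in> X"
  have "(\<lambda>n. \<Sum>i<m. \<Sum>j<m. c i * c j * f n (x i) (x j))
      \<longlonglongrightarrow> (\<Sum>i<m. \<Sum>j<m. c i * c j * g (x i) (x j))"
    using x by (intro tendsto_sum tendsto_mult tendsto_const lim) auto
  moreover have "0 \<le> (\<Sum>i<m. \<Sum>j<m. c i * c j * f n (x i) (x j))" for n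
    using pd[of n] x by (simp add: positive_definite_kernel_def)
  ultimately show "0 \<le> (\<Sum>i<m. \<Sum>j<m. c i * c j * g (x i) (x j))"
    by (blast intro: LIMSEQ_le_const)
qed

lemma positive_definite_kernel_suminf:
  assumes "\<And>i. positive_definite_kernel X (f i)"
    and "\<And>x y. x \<in> X \<Longrightarrow> y \<in> X \<Longrightarrow> summable (\<lambda>i. f i x y)"
  shows "positive_definite_kernel X (\<lambda>x y. \<Sum>i. f i x y)"
  by (rule positive_definite_kernel_limit[where f = "\<lambda>n x y. \<Sum>i<n. f i x y"])
     (auto intro: positive_definite_kernel_sum assms summable_LIMSEQ)

lemma positive_definite_kernel_image:
  assumes "positive_definite_kernel X (\<lambda>x y. f (g x) (g y))"
  shows "positive_definite_kernel (g ` X) f"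
  unfolding positive_definite_kernel_def
proof (intro conjI ballI allI impI)
  fix u v assume "u \<in> g ` X" "v \<in> g ` X"
  then show "f u v = f v u"
    using assms by (auto simp: positive_definite_kernel_def)
next
  fix m :: nat and u and c :: "nat \<Rightarrow> real"
  assume u: "\<forall>i<m. u i \<in> g ` X"
  define x where "x i = inv_into X g (u i)" for i
  have x: "x i \<in> X \<and> u i = g (x i)" if "i < m" for i
    using u that by (simp add: x_def inv_into_into f_inv_into_f)
  have "0 \<le> (\<Sum>i<m. \<Sum>j<m. c i * c j * f (g (x i)) (g (x j)))"
    using assms x by (simp add: positive_definite_kernel_def)
  also have "\<dots> = (\<Sum>i<m. \<Sum>j<m. c i * c j * f (u i) (u j))"
    using x by (intro sum.cong refl) auto
  finally show "0 \<le> (\<Sum>i<m. \<Sum>j<m. c i * c j * f (u i) (u j))" .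
qed

lemma cmod_hermitian_commute: "cmod (hermitian z w) = cmod (hermitian w z)"
proof -
  have "hermitian z w = cnj (hermitian w z)"
    by (simp add: hermitian_def mult.commute)
  then show ?thesis by simp
qed

text \<open>Cauchy-Schwarz: the triangle inequality reduces it to the real inequality for the moduli
  of the coordinates.\<close>

lemma cmod_hermitian_le: "cmod (hermitian z w) \<le> norm z * norm w"
proof -
  have "cmod (hermitian z w) \<le> (\<Sum>i\<in>UNIV. \<bar>cmod (z $ i)\<bar> * \<bar>cmod (w $ i)\<bar>)"
    unfolding hermitian_def by (rule order_trans[OF norm_sum]) (simp add: norm_mult)
  also have "\<dots> \<le> norm z * norm w"
    unfolding norm_vec_def by (rule L2_set_mult_ineq)
  finally show ?thesis .
qed

text \<open>Each coordinate contributes a quadratic form of \<open>M\<close> whose coefficients are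
  \<open>c i\<close> times that coordinate of \<open>z i\<close> or its conjugate. These are complex
  even for real \<open>c\<close>, hence the hypothesis on all complex coefficients. Real parts are
  taken because \<open>M\<close> is an arbitrary complex matrix.\<close>

lemma Re_quadratic_form_hermitian_nonneg:
  fixes z :: "nat \<Rightarrow> complex ^ 'n" and M :: "nat \<Rightarrow> nat \<Rightarrow> complex"
  assumes "\<And>c. 0 \<le> Re (\<Sum>i<m. \<Sum>j<m. c i * cnj (c j) * M i j)"
  shows "0 \<le> Re (\<Sum>i<m. \<Sum>j<m. c i * cnj (c j) * (hermitian (z i) (z j) * M i j))"
    and "0 \<le> Re (\<Sum>i<m. \<Sum>j<m. c i * cnj (c j) * (cnj (hermitian (z i) (z j)) * M i j))"
proof -
  \<comment> \<open>Common form of both claims: \<open>y i\<close> holds the coordinates of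
    \<open>z i\<close> for the first and their conjugates for the second.\<close>
  have *: "0 \<le> Re (\<Sum>i<m. \<Sum>j<m. c i * cnj (c j) * ((\<Sum>p\<in>UNIV. y i p * cnj (y j p)) * M i j))"
    for y :: "nat \<Rightarrow> 'n \<Rightarrow> complex"
  proof -
    have "(\<Sum>i<m. \<Sum>j<m. c i * cnj (c j) * ((\<Sum>p\<in>UNIV. y i p * cnj (y j p)) * M i j))
        = (\<Sum>i<m. \<Sum>j<m. \<Sum>p\<in>UNIV. (c i * y i p) * cnj (c j * y j p) * M i j)"
      by (simp add: sum_distrib_left sum_distrib_right mult_ac)
    also have "\<dots> = (\<Sum>i<m. \<Sum>p\<in>UNIV. \<Sum>j<m. (c i * y i p) * cnj (c j * y j p) * M i j)"
      by (intro sum.cong refl sum.swap)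
    also have "\<dots> = (\<Sum>p\<in>UNIV. \<Sum>i<m. \<Sum>j<m. (c i * y i p) * cnj (c j * y j p) * M i j)"
      by (rule sum.swap)
    also have "Re \<dots> = (\<Sum>p\<in>UNIV. Re (\<Sum>i<m. \<Sum>j<m. (c i * y i p) * cnj (c j * y j p) * M i j))"
      by (rule Re_sum)
    also have "\<dots> \<ge> 0"
      by (intro sum_nonneg assms)
    finally show ?thesis .
  qed
  show "0 \<le> Re (\<Sum>i<m. \<Sum>j<m. c i * cnj (c j) * (hermitian (z i) (z j) * M i j))"
    using *[of "\<lambda>i p. z i $ p"] by (simp add: hermitian_def)
  show "0 \<le> Re (\<Sum>i<m. \<Sum>j<m. c i * cnj (c j) * (cnj (hermitian (z i) (z j)) * M i j))"
    using *[of "\<lambda>i p. cnj (z i $ p)"] by (simp add: hermitian_def)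
qed

lemma positive_definite_kernel_cmod_hermitian_power:
  "positive_definite_kernel X (\<lambda>z w. cmod (hermitian z w) ^ (2 * n))"
  unfolding positive_definite_kernel_def
proof (intro conjI ballI allI impI)
  fix z w :: "complex ^ 'n"
  show "cmod (hermitian z w) ^ (2 * n) = cmod (hermitian w z) ^ (2 * n)"
    by (simp add: cmod_hermitian_commute)
next
  fix m :: nat and z :: "nat \<Rightarrow> complex ^ 'n" and c :: "nat \<Rightarrow> real"
  \<comment> \<open>Although the kernel is real, it is embedded into the complex numbers so that the
    induction can run over all complex coefficients \<open>d\<close>.\<close>
  define M where "M n i j = complex_of_real (cmod (hermitian (z i) (z j)) ^ (2 * n))" for n i j
  have "0 \<le> Re (\<Sum>i<m. \<Sum>j<m. d i * cnj (d j) * M n i j)" for d :: "nat \<Rightarrow> complex"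
  proof (induction n arbitrary: d)
    case 0
    \<comment> \<open>The zeroth power is the constant kernel 1, whose form is the squared modulus
      of the sum of the coefficients.\<close>
    have "(\<Sum>i<m. \<Sum>j<m. d i * cnj (d j) * M 0 i j) = (\<Sum>i<m. d i) * cnj (\<Sum>i<m. d i)"
      by (simp add: M_def sum_product)
    also have "\<dots> = complex_of_real ((cmod (\<Sum>i<m. d i))\<^sup>2)"
      by (rule complex_norm_square[symmetric])
    finally show ?case
      by simp
  next
    case (Suc n)
    \<comment> \<open>Passing to the next even power multiplies by \<open>h * cnj h\<close>, where h
      is the Hermitian product; the two factors are absorbed one after the other.\<close>
    have "M (Suc n) i j = cnj (hermitian (z i) (z j)) * (hermitian (z i) (z j) * M n i j)" for i j
    proof -
      have "M (Suc n) i j = complex_of_real ((cmod (hermitian (z i) (z j)))\<^sup>2) * M n i j"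
        by (simp add: M_def power2_eq_square)
      then show ?thesis
        by (simp only: complex_norm_square mult_ac)
    qed
    then show ?case
      by (simp only:) (intro Re_quadratic_form_hermitian_nonneg Suc)
  qed
  from this[of "\<lambda>i. complex_of_real (c i)"]
  show "0 \<le> (\<Sum>i<m. \<Sum>j<m. c i * c j * cmod (hermitian (z i) (z j)) ^ (2 * n))"
    by (simp add: M_def Re_sum)
qed

lemma cmod_hermitian_preshapes_le_1:
  "z \<in> preshapes \<Longrightarrow> w \<in> preshapes \<Longrightarrow> cmod (hermitian z w) \<le> 1"
  using cmod_hermitian_le[of z w] by (simp add: preshapes_def)

text \<open>The even powers are \<open>t ^ n\<close> with t the squared modulus. On pre-shapes t
  lies in [0, 1], so the powers tend to 0 unless t = 1, where they are constantly 1.\<close>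

lemma positive_definite_kernel_indicator_cmod_hermitian:
  "positive_definite_kernel preshapes (\<lambda>z w. indicator {1} ((cmod (hermitian z w))\<^sup>2))"
proof (rule positive_definite_kernel_limit[where f = "\<lambda>n z w. cmod (hermitian z w) ^ (2 * n)"])
  fix z w :: "complex ^ 'n" assume "z \<in> preshapes" "w \<in> preshapes"
  define t where "t = (cmod (hermitian z w))\<^sup>2"
  have t: "0 \<le> t" "t \<le> 1"
    using cmod_hermitian_preshapes_le_1[OF \<open>z \<in> preshapes\<close> \<open>w \<in> preshapes\<close>]
    by (simp_all add: t_def power_le_one)
  have "(\<lambda>n. t ^ n) \<longlonglongrightarrow> indicator {1} t"
  proof (cases "t = 1")
    case False
    with t show ?thesis by (simp add: LIMSEQ_realpow_zero)
  qed simp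
  then show "(\<lambda>n. cmod (hermitian z w) ^ (2 * n)) \<longlonglongrightarrow> indicator {1} ((cmod (hermitian z w))\<^sup>2)"
    by (simp add: t_def power_mult)
qed (rule positive_definite_kernel_cmod_hermitian_power)

lemma shape_space_eq_image: "shape_space = shape ` preshapes"
  by (auto simp: shape_space_def shape_def quotient_def)

theorem corollary4p6:
  fixes k :: "(complex ^ 'n) set \<Rightarrow> (complex ^ 'n) set \<Rightarrow> real"
    and a :: "int \<Rightarrow> real"
  assumes "CARD('n) \<ge> 2"
    and "\<And>i. i \<ge> -1 \<Longrightarrow> a i \<ge> 0"
    and "a summable_on {-1..}"
    and "\<And>z\<^sub>1 z\<^sub>2. z\<^sub>1 \<in> preshapes \<Longrightarrow> z\<^sub>2 \<in> preshapes \<Longrightarrow>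
           k (shape z\<^sub>1) (shape z\<^sub>2) =
             (\<Sum>i. a (int i) * cmod (hermitian z\<^sub>1 z\<^sub>2) ^ (2 * i))
             + a (-1) * indicator {1} ((cmod (hermitian z\<^sub>1 z\<^sub>2))\<^sup>2)"
  shows "radial_kernel shape_space d_FP k \<and> positive_definite_kernel shape_space k"
proof
  note nonneg = assms(2) and k = assms(4)
  \<comment> \<open>Obtained by solving the distance formula for the squared modulus, which is
    \<open>1 - d\<^sup>2\<close>.\<close>
  define \<phi> where
    "\<phi> d = (\<Sum>i. a (int i) * (1 - d\<^sup>2) ^ i) + a (-1) * indicator {1} (1 - d\<^sup>2)" for d :: real
  have "k (shape z) (shape w) = \<phi> (d_FP (shape z) (shape w))"
    if zw: "z \<in> preshapes" "w \<in> preshapes" for z w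
  proof -
    \<comment> \<open>This makes the argument of the square root in \<open>d_FP\<close> nonnegative,
      so squaring the distance recovers it.\<close>
    have "(cmod (hermitian z w))\<^sup>2 \<le> 1"
      using cmod_hermitian_preshapes_le_1[OF zw] by (simp add: power_le_one)
    then have "1 - (d_FP (shape z) (shape w))\<^sup>2 = (cmod (hermitian z w))\<^sup>2"
      by (simp add: d_FP_shape[OF zw])
    then show ?thesis
      by (simp add: k[OF zw] \<phi>_def power_mult)
  qed
  then show "radial_kernel shape_space d_FP k"
    unfolding radial_kernel_def shape_space_eq_image by blast
  \<comment> \<open>Dropping the index -1 and reindexing along \<open>int\<close> turns summability
    over the integers from -1 on into convergence of an ordinary series.\<close>
  have "a summable_on range int"
    using assms(3) by (rule summable_on_subset_banach) auto
  then have "summable (\<lambda>i. a (int i))"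
    by (subst (asm) summable_on_reindex) (auto simp: o_def intro: summable_on_imp_summable)
  \<comment> \<open>Comparison with the series of the \<open>a (int i)\<close>: the powers of the
    modulus are at most 1.\<close>
  then have summable: "summable (\<lambda>i. a (int i) * cmod (hermitian z w) ^ (2 * i))"
    if "z \<in> preshapes" "w \<in> preshapes" for z w :: "complex ^ 'n"
  proof (rule summable_comparison_test_ev[rotated], intro always_eventually allI)
    fix i
    have "cmod (hermitian z w) ^ (2 * i) \<le> 1"
      using cmod_hermitian_preshapes_le_1[OF that] by (simp add: power_le_one)
    then show "norm (a (int i) * cmod (hermitian z w) ^ (2 * i)) \<le> a (int i)"
      using nonneg[of "int i"] by (simp add: abs_mult mult_left_le)
  qed
  have "positive_definite_kernel preshapes (\<lambda>z w :: complex ^ 'n.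
      (\<Sum>i. a (int i) * cmod (hermitian z w) ^ (2 * i))
      + a (-1) * indicator {1} ((cmod (hermitian z w))\<^sup>2))"
  proof (rule positive_definite_kernel_add)
    show "positive_definite_kernel preshapes
        (\<lambda>z w :: complex ^ 'n. \<Sum>i. a (int i) * cmod (hermitian z w) ^ (2 * i))"
      by (intro positive_definite_kernel_suminf positive_definite_kernel_cmult
            positive_definite_kernel_cmod_hermitian_power summable nonneg) simp_all
    show "positive_definite_kernel preshapes
        (\<lambda>z w :: complex ^ 'n. a (-1) * indicator {1} ((cmod (hermitian z w))\<^sup>2))"
      by (intro positive_definite_kernel_cmult
            positive_definite_kernel_indicator_cmod_hermitian nonneg) simp
  qed
  then have "positive_definite_kernel preshapes (\<lambda>z w. k (shape z) (shape w))"
    using positive_definite_kernel_cong[OF k] by (rule iffD2[rotated])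
  then show "positive_definite_kernel shape_space k"
    unfolding shape_space_eq_image by (rule positive_definite_kernel_image)
qed

end
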